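(* Let $\succsim$ be a quasi-precedence and $\sigma$ a status, and let $\mathcal A_{\max}$ be the algebra induced by a weight function $(w,w_0)$ and a subterm penalty function $p$. If $w_0=0$, $w(f)=0$ and $p(f,i)=0$ for all $f\in\Sigma_n$ and $i\in\{1,\dots,n\}$, then $\succ_{\mathrm{LPO}}=\succ_{\mathrm{WPO}(\mathcal A_{\max})}$, both induced by $\succsim$ and $\sigma$.
   Context: Terms over a finite signature $\Sigma$ and variables $\mathcal V$. A quasi-precedence $\succsim$ is a quasi-order on $\Sigma$ with well-founded strict part $\succ$ and equivalence $\sim$. A status $\sigma$ maps $f\in\Sigma_n$ to a permutation $[i_1..i_n]$ of $\{1..n\}$; $\sigma(f)(s_1..s_n)=[s_{i_1},\dots,s_{i_n}]$. For strict $\succ$ with reflexive closure $\succeq$: $[s_1..s_n]\succ^{\mathrm{lex}}[t_1..t_m]$ iff there is $k<n$ with $s_i\succeq t_i$ for $i\le k$ and either $k=m$, or $k<m$ and $s_{k+1}\succ t_{k+1}$. LPO: no variable is greater than any term; $s=f(s_1..s_n)\succ_{\mathrm{LPO}}t$ iff (a) $s_i\succeq_{\mathrm{LPO}}t$ for some $i$, or (b) $t=g(t_1..t_m)$, $s\succ_{\mathrm{LPO}}t_j$ for all $j$, and either $f\succ g$, or $f\sim g$ and $\sigma(f)(s_1..s_n)\succ_{\mathrm{LPO}}^{\mathrm{lex}}\sigma(g)(t_1..t_m)$. A weight function $(w,w_0)$: $w:\Sigma\to\mathbb N$, $w_0\in\mathbb N$, $w(c)\ge w_0$ for constants. A subterm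 penalty function gives $p(f,i)\in\mathbb N$ for $f\in\Sigma_n$, $1\le i\le n$. $\mathcal A_{\max}$: carrier $\{a\in\mathbb N\mid a\ge w_0\}$, usual $\ge,>$, $f_{\mathcal A}(a_1..a_n)=\max(w(f),\max_i(p(f,i)+a_i))$. $s\ge_{\mathcal A}t$ (resp. $>_{\mathcal A}$) iff $\hat\alpha(s)\ge\hat\alpha(t)$ (resp. $>$) for all assignments $\alpha$. WPO for an algebra $\mathcal A$: no variable is greater than any term; $s=f(s_1..s_n)\succ_{\mathrm{WPO}(\mathcal A)}t$ iff (1) $s>_{\mathcal A}t$, or (2) $s\ge_{\mathcal A}t$ and either (a) $s_i\succeq_{\mathrm{WPO}(\mathcal A)}t$ for some $i$, or (b) $t=g(t_1..t_m)$, $s\succ_{\mathrm{WPO}(\mathcal A)}t_j$ for all $j$, and $f\succ g$, or $f\sim g$ and $\sigma(f)(s_1..s_n)\succ_{\mathrm{WPO}(\mathcal A)}^{\mathrm{lex}}\sigma(g)(t_1..t_m)$. *)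

theory Defs
  imports Main
begin

datatype ('f, 'v) trm = Var 'v | Fun 'f "('f, 'v) trm list"

text \<open>A signature is a set \<open>F\<close> of function symbols together with an arity function \<open>ar\<close>.\<close>

inductive_set trms :: "'f set \<Rightarrow> ('f \<Rightarrow> nat) \<Rightarrow> ('f, 'v) trm set"
  for F :: "'f set" and ar :: "'f \<Rightarrow> nat" where
  Var: "Var x \<in> trms F ar"
| Fun: "f \<in> F \<Longrightarrow> length ts = ar f \<Longrightarrow> (\<And>t. t \<in> set ts \<Longrightarrow> t \<in> trms F ar) \<Longrightarrow> Fun f ts \<in> trms F ar"

text \<open>\<open>(f, g) \<in> Q\<close> means \<open>f \<succsim> g\<close>.\<close>

definition prec_gt :: "'f rel \<Rightarrow> 'f \<Rightarrow> 'f \<Rightarrow> bool" where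
  "prec_gt Q f g \<longleftrightarrow> (f, g) \<in> Q \<and> (g, f) \<notin> Q"

definition prec_eq :: "'f rel \<Rightarrow> 'f \<Rightarrow> 'f \<Rightarrow> bool" where
  "prec_eq Q f g \<longleftrightarrow> (f, g) \<in> Q \<and> (g, f) \<in> Q"

definition quasi_precedence :: "'f set \<Rightarrow> 'f rel \<Rightarrow> bool" where
  "quasi_precedence F Q \<longleftrightarrow> preorder_on F Q \<and> wf {(g, f). prec_gt Q f g}"

text \<open>Argument positions are counted from 1, list positions from 0.\<close>

definition status :: "'f set \<Rightarrow> ('f \<Rightarrow> nat) \<Rightarrow> ('f \<Rightarrow> nat list) \<Rightarrow> bool" where
  "status F ar \<sigma> \<longleftrightarrow> (\<forall>f\<in>F. distinct (\<sigma> f) \<and> set (\<sigma> f) = {1..ar f})"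

definition permute :: "nat list \<Rightarrow> 'a list \<Rightarrow> 'a list" where
  "permute is xs = map (\<lambda>i. xs ! (i - 1)) is"

definition lex_gt :: "('a \<Rightarrow> 'a \<Rightarrow> bool) \<Rightarrow> 'a list \<Rightarrow> 'a list \<Rightarrow> bool" where
  "lex_gt gt ss ts \<longleftrightarrow>
    (\<exists>k < length ss. (\<forall>i < k. gt\<^sup>=\<^sup>= (ss ! i) (ts ! i)) \<and>
      (k = length ts \<or> k < length ts \<and> gt (ss ! k) (ts ! k)))"

lemma lex_gt_mono [mono]:
  assumes "\<And>x y. gt x y \<longrightarrow> gt' x y"
  shows "lex_gt gt ss ts \<longrightarrow> lex_gt gt' ss ts"
proof
  assume "lex_gt gt ss ts"
  then obtain k where "k < length ss" "\<forall>i < k. gt\<^sup>=\<^sup>= (ss ! i) (ts ! i)"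
    "k = length ts \<or> k < length ts \<and> gt (ss ! k) (ts ! k)"
    unfolding lex_gt_def by auto
  with assms show "lex_gt gt' ss ts"
    unfolding lex_gt_def by (intro exI[of _ k]) auto
qed

text \<open>
  Both path orders are introduced as least relations on raw terms. Since every recursive
  call on terms over the signature is at a pair of smaller total size, the recursive
  characterisations (\<open>lpo_Fun_iff\<close>, \<open>wpo_Fun_iff\<close>) determine them
  uniquely on those terms.
\<close>

inductive lpo :: "'f rel \<Rightarrow> ('f \<Rightarrow> nat list) \<Rightarrow> ('f, 'v) trm \<Rightarrow> ('f, 'v) trm \<Rightarrow> bool"
  for Q :: "'f rel" and \<sigma> :: "'f \<Rightarrow> nat list" where
  sub: "s \<in> set ss \<Longrightarrow> lpo Q \<sigma> s t \<or> s = t \<Longrightarrow> lpo Q \<sigma> (Fun f ss) t"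
| prec: "\<forall>t \<in> set ts. lpo Q \<sigma> (Fun f ss) t \<Longrightarrow> prec_gt Q f g \<Longrightarrow>
    lpo Q \<sigma> (Fun f ss) (Fun g ts)"
| lex: "\<forall>t \<in> set ts. lpo Q \<sigma> (Fun f ss) t \<Longrightarrow> prec_eq Q f g \<Longrightarrow>
    lex_gt (lpo Q \<sigma>) (permute (\<sigma> f) ss) (permute (\<sigma> g) ts) \<Longrightarrow>
    lpo Q \<sigma> (Fun f ss) (Fun g ts)"

lemma not_lpo_Var: "\<not> lpo Q \<sigma> (Var x) t"
  by (auto elim: lpo.cases)

lemma lpo_Fun_iff:
  "lpo Q \<sigma> (Fun f ss) t \<longleftrightarrow>
    (\<exists>s \<in> set ss. lpo Q \<sigma> s t \<or> s = t) \<or>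
    (\<exists>g ts. t = Fun g ts \<and> (\<forall>t' \<in> set ts. lpo Q \<sigma> (Fun f ss) t') \<and>
      (prec_gt Q f g \<or>
       prec_eq Q f g \<and> lex_gt (lpo Q \<sigma>) (permute (\<sigma> f) ss) (permute (\<sigma> g) ts)))"
  by (subst lpo.simps) auto

record ('f, 'a) algebra =
  universe :: "'a set"
  interp :: "'f \<Rightarrow> 'a list \<Rightarrow> 'a"
  geq :: "'a \<Rightarrow> 'a \<Rightarrow> bool"
  gtr :: "'a \<Rightarrow> 'a \<Rightarrow> bool"

primrec eval :: "('f, 'a) algebra \<Rightarrow> ('v \<Rightarrow> 'a) \<Rightarrow> ('f, 'v) trm \<Rightarrow> 'a" where
  "eval A \<alpha> (Var x) = \<alpha> x"
| "eval A \<alpha> (Fun f ts) = interp A f (map (eval A \<alpha>) ts)"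

definition alg_geq :: "('f, 'a) algebra \<Rightarrow> ('f, 'v) trm \<Rightarrow> ('f, 'v) trm \<Rightarrow> bool" where
  "alg_geq A s t \<longleftrightarrow> (\<forall>\<alpha>. range \<alpha> \<subseteq> universe A \<longrightarrow> geq A (eval A \<alpha> s) (eval A \<alpha> t))"

definition alg_gtr :: "('f, 'a) algebra \<Rightarrow> ('f, 'v) trm \<Rightarrow> ('f, 'v) trm \<Rightarrow> bool" where
  "alg_gtr A s t \<longleftrightarrow> (\<forall>\<alpha>. range \<alpha> \<subseteq> universe A \<longrightarrow> gtr A (eval A \<alpha> s) (eval A \<alpha> t))"

inductive wpo ::
  "'f rel \<Rightarrow> ('f \<Rightarrow> nat list) \<Rightarrow> ('f, 'a) algebra \<Rightarrow> ('f, 'v) trm \<Rightarrow> ('f, 'v) trm \<Rightarrow> bool"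
  for Q :: "'f rel" and \<sigma> :: "'f \<Rightarrow> nat list" and A :: "('f, 'a) algebra" where
  alg: "alg_gtr A (Fun f ss) t \<Longrightarrow> wpo Q \<sigma> A (Fun f ss) t"
| sub: "alg_geq A (Fun f ss) t \<Longrightarrow> s \<in> set ss \<Longrightarrow> wpo Q \<sigma> A s t \<or> s = t \<Longrightarrow> wpo Q \<sigma> A (Fun f ss) t"
| prec: "alg_geq A (Fun f ss) (Fun g ts) \<Longrightarrow>
    \<forall>t \<in> set ts. wpo Q \<sigma> A (Fun f ss) t \<Longrightarrow> prec_gt Q f g \<Longrightarrow>
    wpo Q \<sigma> A (Fun f ss) (Fun g ts)"
| lex: "alg_geq A (Fun f ss) (Fun g ts) \<Longrightarrow>
    \<forall>t \<in> set ts. wpo Q \<sigma> A (Fun f ss) t \<Longrightarrow> prec_eq Q f g \<Longrightarrow>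
    lex_gt (wpo Q \<sigma> A) (permute (\<sigma> f) ss) (permute (\<sigma> g) ts) \<Longrightarrow>
    wpo Q \<sigma> A (Fun f ss) (Fun g ts)"

lemma not_wpo_Var: "\<not> wpo Q \<sigma> A (Var x) t"
  by (auto elim: wpo.cases)

lemma wpo_Fun_iff:
  "wpo Q \<sigma> A (Fun f ss) t \<longleftrightarrow>
    alg_gtr A (Fun f ss) t \<or>
    alg_geq A (Fun f ss) t \<and>
    ((\<exists>s \<in> set ss. wpo Q \<sigma> A s t \<or> s = t) \<or>
     (\<exists>g ts. t = Fun g ts \<and> (\<forall>t' \<in> set ts. wpo Q \<sigma> A (Fun f ss) t') \<and>
       (prec_gt Q f g \<or>
        prec_eq Q f g \<and> lex_gt (wpo Q \<sigma> A) (permute (\<sigma> f) ss) (permute (\<sigma> g) ts))))"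
  by (subst wpo.simps) auto

definition LPO :: "'f set \<Rightarrow> ('f \<Rightarrow> nat) \<Rightarrow> 'f rel \<Rightarrow> ('f \<Rightarrow> nat list) \<Rightarrow> ('f, 'v) trm rel" where
  "LPO F ar Q \<sigma> = {(s, t). s \<in> trms F ar \<and> t \<in> trms F ar \<and> lpo Q \<sigma> s t}"

definition WPO ::
  "'f set \<Rightarrow> ('f \<Rightarrow> nat) \<Rightarrow> 'f rel \<Rightarrow> ('f \<Rightarrow> nat list) \<Rightarrow> ('f, 'a) algebra \<Rightarrow> ('f, 'v) trm rel" where
  "WPO F ar Q \<sigma> A = {(s, t). s \<in> trms F ar \<and> t \<in> trms F ar \<and> wpo Q \<sigma> A s t}"

definition weight_function :: "'f set \<Rightarrow> ('f \<Rightarrow> nat) \<Rightarrow> ('f \<Rightarrow> nat) \<Rightarrow> nat \<Rightarrow> bool" where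
  "weight_function F ar w w0 \<longleftrightarrow> (\<forall>c\<in>F. ar c = 0 \<longrightarrow> w0 \<le> w c)"

definition A_max :: "('f \<Rightarrow> nat) \<Rightarrow> nat \<Rightarrow> ('f \<Rightarrow> nat \<Rightarrow> nat) \<Rightarrow> ('f, nat) algebra" where
  "A_max w w0 p =
    \<lparr>universe = {a. w0 \<le> a},
     interp = (\<lambda>f as. Max (insert (w f) {p f i + as ! (i - 1) | i. i \<in> {1..length as}})),
     geq = (\<ge>),
     gtr = (>)\<rparr>"

end

theory Submission
  imports Defs
begin

text \<open>
  With all weights and penalties zero, a term evaluates to the maximum of the values of its
  variables. Under the zero assignment everything evaluates to 0, so the strict algebra
  comparison never holds. Conversely an LPO-larger term evaluates at least as high, so the weak
  comparison that guards the recursive cases of WPO holds automatically, and the two recursive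
  definitions coincide.
\<close>

lemma Fun_in_trms_iff:
  "Fun f ts \<in> trms F ar \<longleftrightarrow> f \<in> F \<and> length ts = ar f \<and> set ts \<subseteq> trms F ar"
  by (auto elim: trms.cases intro: trms.Fun)

lemma set_permute_subset:
  assumes "set is \<subseteq> {1..length xs}"
  shows "set (permute is xs) \<subseteq> set xs"
  using assms by (fastforce simp: permute_def intro: nth_mem)

text \<open>Ensures that lexicographic comparisons of permuted arguments stay inside
  \<open>trms F ar\<close>, where the induction hypotheses apply.\<close>

lemma set_permute_status_subset_trms:
  assumes "status F ar \<sigma>" "Fun f ts \<in> trms F ar"
  shows "set (permute (\<sigma> f) ts) \<subseteq> trms F ar"
proof -
  have "set (permute (\<sigma> f) ts) \<subseteq> set ts"
    using assms by (intro set_permute_subset) (auto simp: status_def Fun_in_trms_iff)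
  then show ?thesis
    using assms(2) by (auto simp: Fun_in_trms_iff)
qed

text \<open>Relativises \<open>lex_gt_mono\<close> to list elements, because the implications
  between the two orders are available only for terms over the signature.\<close>

lemma lex_gt_mono_on:
  assumes "lex_gt gt ss ts"
    and "\<And>x y. x \<in> set ss \<Longrightarrow> y \<in> set ts \<Longrightarrow> gt x y \<Longrightarrow> gt' x y"
  shows "lex_gt gt' ss ts"
proof -
  from assms(1) obtain k where k: "k < length ss" "\<forall>i<k. gt\<^sup>=\<^sup>= (ss ! i) (ts ! i)"
    "k = length ts \<or> k < length ts \<and> gt (ss ! k) (ts ! k)"
    unfolding lex_gt_def by blast
  have "gt'\<^sup>=\<^sup>= (ss ! i) (ts ! i)" if "i < k" for i
  proof -
    \<comment> \<open>Both alternatives for \<open>k\<close> give \<open>k \<le> length ts\<close>,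
      so \<open>i\<close> is a valid index of both lists.\<close>
    have "ss ! i \<in> set ss" "ts ! i \<in> set ts" using k that by auto
    then show ?thesis using k(2) that assms(2) by blast
  qed
  moreover have "k = length ts \<or> k < length ts \<and> gt' (ss ! k) (ts ! k)"
    using k assms(2) by auto
  ultimately show ?thesis
    using k(1) unfolding lex_gt_def by blast
qed

text \<open>Rule induction: \<open>alg\<close> contradicts \<open>no_gtr\<close>, and every other
  WPO rule turns into the LPO rule of the same name when its algebraic guard is dropped.\<close>

lemma wpo_imp_lpo:
  fixes s t :: "('f, 'v) trm"
  assumes st: "status F ar \<sigma>"
    and no_gtr: "\<And>s t :: ('f, 'v) trm. s \<in> trms F ar \<Longrightarrow> t \<in> trms F ar \<Longrightarrow> \<not> alg_gtr A s t"
    and "wpo Q \<sigma> A s t" "s \<in> trms F ar" "t \<in> trms F ar"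
  shows "lpo Q \<sigma> s t"
  using assms(3-)
proof (induction rule: wpo.induct)
  case (alg f ss t)
  then show ?case using no_gtr by blast
next
  case (sub f ss t s)
  then show ?case by (auto simp: Fun_in_trms_iff intro: lpo.sub)
next
  case (prec f ss g ts)
  then show ?case by (intro lpo.prec) (auto simp: Fun_in_trms_iff)
next
  case (lex f ss g ts)
  have "lex_gt (lpo Q \<sigma>) (permute (\<sigma> f) ss) (permute (\<sigma> g) ts)"
    \<comment> \<open>\<open>lex.IH(2)\<close> compares by the conjunction of \<open>wpo\<close> and
      the guarded implication to \<open>lpo\<close>; the guards are discharged elementwise.\<close>
    using lex.IH(2) by (rule lex_gt_mono_on)
      (use set_permute_status_subset_trms[OF st] lex.prems in blast)
  with lex show ?case by (intro lpo.lex) (auto simp: Fun_in_trms_iff)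
qed

lemma lpo_imp_wpo:
  fixes s t :: "('f, 'v) trm"
  assumes st: "status F ar \<sigma>"
    and lpo_geq: "\<And>s t :: ('f, 'v) trm. lpo Q \<sigma> s t \<Longrightarrow> s \<in> trms F ar \<Longrightarrow> t \<in> trms F ar \<Longrightarrow>
      alg_geq A s t"
    and "lpo Q \<sigma> s t" "s \<in> trms F ar" "t \<in> trms F ar"
  shows "wpo Q \<sigma> A s t"
  using assms(3-)
proof (induction rule: lpo.induct)
  case (sub s ss t f)
  \<comment> \<open>The LPO conclusion of the case is rebuilt because \<open>lpo_geq\<close> derives
    the WPO guard from it.\<close>
  then have "lpo Q \<sigma> (Fun f ss) t" by (blast intro: lpo.sub)
  with sub show ?case by (auto simp: Fun_in_trms_iff intro!: wpo.sub lpo_geq)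
next
  case (prec ts f ss g)
  then have "lpo Q \<sigma> (Fun f ss) (Fun g ts)" by (blast intro: lpo.prec)
  with prec show ?case by (intro wpo.prec lpo_geq) (auto simp: Fun_in_trms_iff)
next
  case (lex ts f ss g)
  have "lex_gt (lpo Q \<sigma>) (permute (\<sigma> f) ss) (permute (\<sigma> g) ts)"
    using lex.IH(2) by (rule lex_gt_mono_on) blast
  with lex have "lpo Q \<sigma> (Fun f ss) (Fun g ts)" by (blast intro: lpo.lex)
  moreover have "lex_gt (wpo Q \<sigma> A) (permute (\<sigma> f) ss) (permute (\<sigma> g) ts)"
    using lex.IH(2) by (rule lex_gt_mono_on)
      (use set_permute_status_subset_trms[OF st] lex.prems in blast)
  ultimately show ?case using lex by (intro wpo.lex lpo_geq) (auto simp: Fun_in_trms_iff)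
qed

text \<open>The inserted 0 is the weight of \<open>f\<close>. It keeps \<open>Max\<close> meaningful
  for constants and is neutral otherwise, as values are naturals.\<close>

lemma eval_A_max_zero_Fun:
  assumes "\<forall>f\<in>F. w f = 0" "\<forall>f\<in>F. \<forall>i\<in>{1..ar f}. p f i = 0"
    and "Fun f ts \<in> trms F ar"
  shows "eval (A_max w w0 p) \<alpha> (Fun f ts) = Max (insert 0 (eval (A_max w w0 p) \<alpha> ` set ts))"
proof -
  have f: "f \<in> F" "length ts = ar f" using assms(3) by (auto simp: Fun_in_trms_iff)
  let ?e = "eval (A_max w w0 p) \<alpha>"
  have "{p f i + map ?e ts ! (i - 1) | i. i \<in> {1..length (map ?e ts)}} =
    (\<lambda>i. p f i + map ?e ts ! (i - 1)) ` {1..length ts}"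
    by auto
  also have "\<dots> = (\<lambda>i. map ?e ts ! (i - 1)) ` {1..length ts}"
    using assms(2) f by (intro image_cong) auto
  \<comment> \<open>Shift from positions counted from 1 to list indices counted from 0, via
    \<open>{1..n}\<close> as the image of \<open>{0..<n}\<close> under \<open>Suc\<close>.\<close>
  also have "\<dots> = (\<lambda>j. ?e (ts ! j)) ` {0..<length ts}"
    unfolding image_Suc_atLeastLessThan[symmetric] atLeastLessThanSuc_atLeastAtMost[symmetric]
      One_nat_def image_image by (intro image_cong) auto
  also have "\<dots> = ?e ` set ts"
    by (metis image_image set_map list.set_map map_nth set_upt)
  finally show ?thesis
    using assms(1) f(1) by (simp add: A_max_def)
qed

lemma eval_A_max_zero_assignment:
  assumes "\<forall>f\<in>F. w f = 0" "\<forall>f\<in>F. \<forall>i\<in>{1..ar f}. p f i = 0"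
    and "t \<in> trms F ar"
  shows "eval (A_max w w0 p) (\<lambda>_. 0) t = 0"
  using assms(3)
proof (induction t)
  case (Fun f ts)
  then have "Fun f ts \<in> trms F ar" by (auto intro: trms.Fun)
  then have "eval (A_max w w0 p) (\<lambda>_. 0) (Fun f ts) =
    Max (insert 0 (eval (A_max w w0 p) (\<lambda>_. 0) ` set ts))"
    by (rule eval_A_max_zero_Fun[OF assms(1,2)])
  also have "\<dots> = 0" using Fun.IH by (intro Max_eqI) auto
  finally show ?case .
qed simp

text \<open>In case \<open>sub\<close> an argument's value is bounded by the maximum over all
  arguments. In the other cases every argument of \<open>t\<close> is LPO-below \<open>s\<close>, so
  by induction the maximum of their values is at most the value of \<open>s\<close>.\<close>

lemma lpo_eval_A_max_zero:
  assumes "\<forall>f\<in>F. w f = 0" "\<forall>f\<in>F. \<forall>i\<in>{1..ar f}. p f i = 0"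
    and "lpo Q \<sigma> s t" "s \<in> trms F ar" "t \<in> trms F ar"
  shows "eval (A_max w w0 p) \<alpha> t \<le> eval (A_max w w0 p) \<alpha> s"
  using assms(3-)
proof (induction rule: lpo.induct)
  case (sub s ss t f)
  let ?e = "eval (A_max w w0 p) \<alpha>"
  have "?e t \<le> ?e s" using sub by (auto simp: Fun_in_trms_iff)
  also have "?e s \<le> ?e (Fun f ss)"
    using sub by (subst eval_A_max_zero_Fun[OF assms(1,2)]) (auto intro!: Max_ge)
  finally show ?case .
next
  case (prec ts f ss g)
  then show ?case
    \<comment> \<open>Only the smaller side is expanded; \<open>eval.simps\<close> is removed so
      that the value of \<open>Fun f ss\<close> still matches the induction hypotheses.\<close>
    by (subst eval_A_max_zero_Fun[OF assms(1,2), of g ts]) (auto simp: Fun_in_trms_iff simp del: eval.simps)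
next
  case (lex ts f ss g)
  then show ?case
    by (subst eval_A_max_zero_Fun[OF assms(1,2), of g ts]) (auto simp: Fun_in_trms_iff simp del: eval.simps)
qed

theorem theorem19:
  fixes F :: "'f set" and ar :: "'f \<Rightarrow> nat"
    and Q :: "'f rel" and \<sigma> :: "'f \<Rightarrow> nat list"
    and w :: "'f \<Rightarrow> nat" and w0 :: nat and p :: "'f \<Rightarrow> nat \<Rightarrow> nat"
  assumes "finite F"
    and "quasi_precedence F Q"
    and "status F ar \<sigma>"
    and "weight_function F ar w w0"
    and "w0 = 0"
    and "\<forall>f\<in>F. w f = 0"
    and "\<forall>f\<in>F. \<forall>i\<in>{1..ar f}. p f i = 0"
  shows "(LPO F ar Q \<sigma> :: ('f, 'v) trm rel) = WPO F ar Q \<sigma> (A_max w w0 p)"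
proof -
  let ?A = "A_max w w0 p"
  have no_gtr: "\<not> alg_gtr ?A s t"
    if "s \<in> trms F ar" "t \<in> trms F ar" for s t :: "('f, 'v) trm"
  proof -
    have "eval ?A (\<lambda>_. 0) s = 0" "eval ?A (\<lambda>_. 0) t = 0"
      using that eval_A_max_zero_assignment[OF assms(6,7)] by blast+
    \<comment> \<open>\<open>w0 = 0\<close> puts 0 into the carrier, so the zero assignment is
      admissible and refutes the strict comparison.\<close>
    moreover have "range (\<lambda>_ :: 'v. 0) \<subseteq> universe ?A" "\<not> gtr ?A 0 0"
      using \<open>w0 = 0\<close> by (auto simp: A_max_def)
    ultimately show ?thesis unfolding alg_gtr_def by metis
  qed
  have lpo_geq: "alg_geq ?A s t"
    if "lpo Q \<sigma> s t" "s \<in> trms F ar" "t \<in> trms F ar" for s t :: "('f, 'v) trm"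
  proof -
    have "geq ?A = (\<ge>)" by (simp add: A_max_def)
    then show ?thesis
      unfolding alg_geq_def using lpo_eval_A_max_zero[OF assms(6,7) that] by simp
  qed
  show ?thesis
    unfolding LPO_def WPO_def
    using lpo_imp_wpo[OF assms(3) lpo_geq] wpo_imp_lpo[OF assms(3) no_gtr] by blast
qed

end
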